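(* Let $\sigma$ be a complex polynomial of degree $\le2$, $\sigma\neq0$, $\kappa$ a complex polynomial of degree $\le1$, $\omega\in\mathbb{C}$, and let $\rho$ be a nonzero solution of $(\sigma(z)\partial_z-\kappa(z))\rho(z)=0$. Then, as differential operators, $$\rho(z)\,\mathcal{H}(\sigma,\kappa)\,\rho^{-1}(z)=\mathcal{H}(\sigma,-\kappa).$$ Hence $$\big(\mathcal{H}(\sigma,\kappa)+\omega\big)F=0\ \Longrightarrow\ \big(\mathcal{H}(\sigma,-\kappa)+\omega\big)\rho F=0 .$$
   Context: For polynomials $\sigma,\kappa$ with $\deg\sigma\le2$, $\deg\kappa\le1$, $$\mathcal{H}(\sigma,\kappa):=\sigma(z)\partial_z^2+\big(\sigma'(z)+\kappa(z)\big)\partial_z+\tfrac12\kappa'.$$ Everything is considered on (simply connected regions of, or the universal cover of) the complement of the zeros of $\sigma$, where $\rho$ is analytic and nowhere zero. The functions $\rho,\rho^{-1}$ are understood as multiplication operators. *)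

theory Defs
  imports
    "HOL-Complex_Analysis.Complex_Analysis"
begin

text \<open>
  A multivalued analytic function on a region \<open>S\<close> is a function on a covering \<open>p\<close> from \<open>X\<close> onto \<open>S\<close>,
  and \<open>p\<close> plays the role of the coordinate \<open>z\<close>. Derivatives are therefore taken with respect to \<open>p\<close>;
  no complex structure on the type \<open>'a\<close> is needed. A region of the complex plane itself is the case
  \<open>p = (\<lambda>z. z)\<close>. The lemmas below relate these notions to the usual complex derivative and to
  \<open>holomorphic_on\<close>.
\<close>

definition has_zderiv ::
    "'a::topological_space set \<Rightarrow> ('a \<Rightarrow> complex) \<Rightarrow> ('a \<Rightarrow> complex) \<Rightarrow> complex \<Rightarrow> 'a \<Rightarrow> bool" where
  "has_zderiv X p f d x \<longleftrightarrow>
     ((\<lambda>y. (f y - f x) / (p y - p x)) \<longlongrightarrow> d) (at x within X)"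

definition zderiv ::
    "'a::topological_space set \<Rightarrow> ('a \<Rightarrow> complex) \<Rightarrow> ('a \<Rightarrow> complex) \<Rightarrow> 'a \<Rightarrow> complex" where
  "zderiv X p f x = Lim (at x within X) (\<lambda>y. (f y - f x) / (p y - p x))"

text \<open>Analyticity on a relatively open subset \<open>V\<close> of \<open>X\<close>.\<close>

definition zholomorphic_on ::
    "'a::topological_space set \<Rightarrow> ('a \<Rightarrow> complex) \<Rightarrow> ('a \<Rightarrow> complex) \<Rightarrow> 'a set \<Rightarrow> bool" where
  "zholomorphic_on X p f V \<longleftrightarrow> (\<forall>x\<in>V. \<exists>d. has_zderiv X p f d x)"

definition mult_op :: "('a \<Rightarrow> complex) \<Rightarrow> ('a \<Rightarrow> complex) \<Rightarrow> 'a \<Rightarrow> complex" where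
  "mult_op r f = (\<lambda>x. r x * f x)"

definition hyp_op ::
    "'a::topological_space set \<Rightarrow> ('a \<Rightarrow> complex) \<Rightarrow> complex poly \<Rightarrow> complex poly \<Rightarrow>
     ('a \<Rightarrow> complex) \<Rightarrow> 'a \<Rightarrow> complex" where
  "hyp_op X p \<sigma> \<kappa> f = (\<lambda>x.
     poly \<sigma> (p x) * zderiv X p (zderiv X p f) x
     + (poly (pderiv \<sigma>) (p x) + poly \<kappa> (p x)) * zderiv X p f x
     + 1 / 2 * poly (pderiv \<kappa>) (p x) * f x)"

text \<open>
  Differential operators act on functions that are analytic on arbitrary open subsets of \<open>X\<close>;
  two of them are equal if they agree on all such functions.
\<close>

definition diffop_eq ::
    "'a::topological_space set \<Rightarrow> ('a \<Rightarrow> complex) \<Rightarrow>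
     (('a \<Rightarrow> complex) \<Rightarrow> 'a \<Rightarrow> complex) \<Rightarrow> (('a \<Rightarrow> complex) \<Rightarrow> 'a \<Rightarrow> complex) \<Rightarrow> bool" where
  "diffop_eq X p A B \<longleftrightarrow>
     (\<forall>V f. openin (top_of_set X) V \<longrightarrow> zholomorphic_on X p f V \<longrightarrow> (\<forall>x\<in>V. A f x = B f x))"

text \<open>In a chart, i.e. on a sheet \<open>U\<close> of the covering with local inverse \<open>q\<close> of \<open>p\<close>,
  the derivative is the complex derivative.\<close>

lemma has_zderiv_chart:
  fixes X :: "'a::topological_space set"
  assumes U: "openin (top_of_set X) U" and T: "open T"
    and h: "homeomorphism U T p q" and x: "x \<in> U"
  shows "has_zderiv X p f d x \<longleftrightarrow> ((f \<circ> q) has_field_derivative d) (at (p x))"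
proof -
  obtain W where W: "open W" "U = X \<inter> W"
    using U by (auto simp: openin_open)
  have aX: "at x within X = at x within U"
    by (rule at_within_nhd[of x W]) (use W x in auto)
  have pT: "p x \<in> T" using h x by (auto simp: homeomorphism_def)
  have aT: "at (p x) within T = at (p x)"
    using pT T by (rule at_within_open)
  have qp: "\<And>y. y \<in> U \<Longrightarrow> q (p y) = y" and pq: "\<And>y. y \<in> T \<Longrightarrow> p (q y) = y"
    and pU: "\<And>y. y \<in> U \<Longrightarrow> p y \<in> T" and qT: "\<And>y. y \<in> T \<Longrightarrow> q y \<in> U"
    using h by (auto simp: homeomorphism_def)
  have cp: "continuous_on U p" and cq: "continuous_on T q"
    using h by (auto simp: homeomorphism_def)
  have ev: "eventually (\<lambda>y. y \<in> U \<and> y \<noteq> x) (at x within U)"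
    by (auto simp: eventually_at_filter)
  have evT: "eventually (\<lambda>y. y \<in> T \<and> y \<noteq> p x) (at (p x))"
    unfolding aT[symmetric] by (auto simp: eventually_at_filter)
  have fp: "filterlim p (at (p x)) (at x within U)"
  proof (unfold filterlim_at, intro conjI)
    show "(p \<longlongrightarrow> p x) (at x within U)"
      using cp x by (simp add: continuous_on_def)
    show "eventually (\<lambda>y. p y \<in> UNIV \<and> p y \<noteq> p x) (at x within U)"
      using ev by (rule eventually_mono) (use qp[OF x] qp in force)
  qed
  have "(q \<longlongrightarrow> q (p x)) (at (p x))"
    using cq pT aT by (auto simp: continuous_on_def)
  moreover have "eventually (\<lambda>y. q y \<in> U \<and> q y \<noteq> x) (at (p x))"
    using evT by (rule eventually_mono) (use pq qT in auto)
  ultimately have fq: "filterlim q (at x within U) (at (p x))"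
    unfolding filterlim_at using qp[OF x] by auto
  let ?g = "\<lambda>w. ((f \<circ> q) w - (f \<circ> q) (p x)) / (w - p x)"
  let ?h = "\<lambda>y. (f y - f x) / (p y - p x)"
  have "(?h \<longlongrightarrow> d) (at x within U) \<longleftrightarrow> (?g \<longlongrightarrow> d) (at (p x))"
  proof
    assume "(?h \<longlongrightarrow> d) (at x within U)"
    then have "((\<lambda>w. ?h (q w)) \<longlongrightarrow> d) (at (p x))"
      by (rule filterlim_compose[OF _ fq])
    then show "(?g \<longlongrightarrow> d) (at (p x))"
      by (rule Lim_transform_eventually)
         (rule eventually_mono[OF evT], use pq qp[OF x] in auto)
  next
    assume "(?g \<longlongrightarrow> d) (at (p x))"
    then have "((\<lambda>y. ?g (p y)) \<longlongrightarrow> d) (at x within U)"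
      by (rule filterlim_compose[OF _ fp])
    then show "(?h \<longlongrightarrow> d) (at x within U)"
      by (rule Lim_transform_eventually)
         (rule eventually_mono[OF ev], use qp qp[OF x] in auto)
  qed
  then show ?thesis
    unfolding has_zderiv_def aX has_field_derivative_iff .
qed

lemma at_within_chart_neq_bot:
  fixes X :: "'a::topological_space set"
  assumes U: "openin (top_of_set X) U" and T: "open T"
    and h: "homeomorphism U T p (q :: complex \<Rightarrow> 'a)" and x: "x \<in> U"
  shows "at x within X \<noteq> bot"
proof
  assume "at x within X = bot"
  then have *: "has_zderiv X p (\<lambda>_. 0) d x" for d
    by (simp add: has_zderiv_def)
  then have "((\<lambda>_. 0) has_field_derivative d) (at (p x))" for d :: complex
    using has_zderiv_chart[OF assms, of "\<lambda>_. 0" d] by (simp add: o_def)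
  from DERIV_unique[OF this[of 0] this[of 1]] show False
    by simp
qed

lemma zderiv_chart:
  fixes X :: "'a::topological_space set"
  assumes U: "openin (top_of_set X) U" and T: "open T"
    and h: "homeomorphism U T p q" and x: "x \<in> U"
    and hol: "zholomorphic_on X p f U"
  shows "zderiv X p f x = deriv (f \<circ> q) (p x)"
proof -
  obtain d where d: "has_zderiv X p f d x"
    using hol x by (auto simp: zholomorphic_on_def)
  then have "zderiv X p f x = d"
    unfolding zderiv_def has_zderiv_def
    by (intro tendsto_Lim at_within_chart_neq_bot[OF U T h x])
  then show ?thesis
    using DERIV_imp_deriv[of "f \<circ> q" d "p x"] has_zderiv_chart[OF U T h x, of f d] d by simp
qed

lemma zholomorphic_on_chart:
  fixes X :: "'a::topological_space set"
  assumes U: "openin (top_of_set X) U" and T: "open T"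
    and h: "homeomorphism U T p q"
  shows "zholomorphic_on X p f U \<longleftrightarrow> (f \<circ> q) holomorphic_on T"
proof -
  have "zholomorphic_on X p f U \<longleftrightarrow> (\<forall>x\<in>U. (f \<circ> q) field_differentiable at (p x))"
    unfolding zholomorphic_on_def field_differentiable_def
    using has_zderiv_chart[OF U T h] by blast
  also have "\<dots> \<longleftrightarrow> (\<forall>y\<in>T. (f \<circ> q) field_differentiable at y)"
    by (simp add: homeomorphism_image1[OF h, symmetric])
  also have "\<dots> \<longleftrightarrow> (f \<circ> q) holomorphic_on T"
    using T by (simp add: holomorphic_on_open field_differentiable_def)
  finally show ?thesis .
qed

lemma region_zholomorphic_on:
  assumes "open S" "open V" "V \<subseteq> S"
  shows "zholomorphic_on S (\<lambda>z. z) f V \<longleftrightarrow> f holomorphic_on V"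
  using zholomorphic_on_chart[of S V V "\<lambda>z. z" "\<lambda>z. z" f] assms
  by (simp add: openin_open_eq homeomorphism_def o_def)

lemma region_zderiv:
  assumes "open S" "open V" "V \<subseteq> S" "f holomorphic_on V" "x \<in> V"
  shows "zderiv S (\<lambda>z. z) f x = deriv f x"
  using zderiv_chart[of S V V "\<lambda>z. z" "\<lambda>z. z" x f] region_zholomorphic_on assms
  by (simp add: openin_open_eq homeomorphism_def o_def)

lemma region_covering_space: "covering_space S (\<lambda>z. z) S"
  by (rule homeomorphism_imp_covering_space[of S S _ "\<lambda>z. z"]) (simp add: homeomorphism_def)

end

theory Submission
  imports Defs
begin

text \<open>
  Locally \<open>\<rho>' = (\<kappa> / \<sigma>) \<rho>\<close>, so \<open>\<rho>\<close> is a constant times \<open>exp H\<close>, where \<open>H\<close> is a primitive of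
  \<open>\<kappa> / \<sigma>\<close>. The zero set of \<open>\<rho>\<close> is therefore open and closed, hence empty.
  The Leibniz rule, together with the derivative \<open>\<sigma> \<rho>'' + \<sigma>' \<rho>' = \<kappa> \<rho>' + \<kappa>' \<rho>\<close> of the equation
  \<open>\<sigma> \<rho>' = \<kappa> \<rho>\<close>, gives \<open>H(\<sigma>, -\<kappa>) (\<rho> u) = \<rho> H(\<sigma>, \<kappa>) u\<close>; both claims are instances
  of this identity.
\<close>

section \<open>Disc charts of a covering, and connectedness\<close>

text \<open>Cut down a sheet \<open>W\<close> through \<open>x\<close>: the homeomorphism
  \<open>p\<close> maps \<open>W \<inter> V\<close> onto an open set, which contains a disc about
  \<open>p x\<close>, and \<open>q\<close> carries this disc back into \<open>V\<close>. A disc is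
  chosen because the convexity of its image will provide primitives.\<close>

lemma covering_space_ball_chart:
  fixes X :: "'a::topological_space set" and S :: "complex set"
  assumes cov: "covering_space X p S" and S: "open S"
    and V: "openin (top_of_set X) V" and x: "x \<in> V"
  obtains U q r where "r > 0" "x \<in> U" "U \<subseteq> V" "openin (top_of_set X) U"
    "homeomorphism U (ball (p x) r) p q" "ball (p x) r \<subseteq> S"
proof -
  have xX: "x \<in> X" using openin_subset[OF V] x by auto
  then have px: "p x \<in> S" using cov by (auto simp: covering_space_def)
  obtain T v where T: "p x \<in> T" "openin (top_of_set S) T" and v: "\<Union>v = X \<inter> p -` T"
    and vo: "\<forall>u\<in>v. openin (top_of_set X) u" and vh: "\<forall>u\<in>v. \<exists>q. homeomorphism u T p q"
    using cov px unfolding covering_space_def by meson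
  have "x \<in> \<Union>v" using v xX T by auto
  then obtain W where W: "W \<in> v" "x \<in> W" by auto
  obtain q where q: "homeomorphism W T p q" using vh W by blast
  have Wo: "openin (top_of_set X) W" using vo W by blast
  have oT: "open T" and TS: "T \<subseteq> S"
    using T S by (auto simp: openin_open_eq)
  have "openin (top_of_set W) (W \<inter> V)"
    using openin_subset_trans[OF openin_Int[OF Wo V], of W] openin_subset[OF Wo] by simp
  then have "openin (top_of_set T) (p ` (W \<inter> V))"
    using homeomorphism_imp_open_map[OF q] by blast
  then have oP: "open (p ` (W \<inter> V))" and PT: "p ` (W \<inter> V) \<subseteq> T"
    using oT by (auto simp: openin_open_eq)
  have "p x \<in> p ` (W \<inter> V)" using W x by auto
  then obtain r where r: "r > 0" "ball (p x) r \<subseteq> p ` (W \<inter> V)"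
    using oP open_contains_ball by blast
  define U where "U = q ` ball (p x) r"
  have qp: "\<And>y. y \<in> W \<Longrightarrow> q (p y) = y" and pq: "\<And>y. y \<in> T \<Longrightarrow> p (q y) = y"
    using q by (auto simp: homeomorphism_def)
  have UWV: "U \<subseteq> W \<inter> V" using r qp by (force simp: U_def)
  have bT: "ball (p x) r \<subseteq> T" using r PT by blast
  have pU: "p ` U = ball (p x) r"
    using bT pq by (force simp: U_def image_image)
  have h: "homeomorphism U (ball (p x) r) p q"
    by (rule homeomorphism_of_subsets[OF q]) (use UWV bT pU in auto)
  have "openin (top_of_set T) (ball (p x) r)"
    using bT oT by (simp add: openin_open_eq)
  then have "openin (top_of_set W) U"
    unfolding U_def using homeomorphism_imp_open_map[OF homeomorphism_symD[OF q]] by blast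
  then have "openin (top_of_set X) U" using Wo by (rule openin_trans)
  moreover have "x \<in> U"
    unfolding U_def using W r qp by (metis centre_in_ball image_eqI)
  ultimately show thesis using that[of r U q] r UWV h bT TS by auto
qed

text \<open>The definition of \<open>simply_connected\<close> makes any two loops freely homotopic,
  so constant loops at two different points as well; a homotopy between constants traces out a path
  joining them.\<close>

lemma simply_connected_imp_connected_general:
  fixes X :: "'a::topological_space set"
  assumes "simply_connected X"
  shows "connected X"
proof -
  have "path_component X a b" if "a \<in> X" "b \<in> X" for a b
  proof -
    have "homotopic_loops X (\<lambda>_. a) (\<lambda>_. b)"
      using assms that unfolding simply_connected_def
      by (simp add: path_def path_image_def pathstart_def pathfinish_def image_subset_iff)
    then have "homotopic_with (\<lambda>_. True) (top_of_set {0..1::real}) (top_of_set X) (\<lambda>_. a) (\<lambda>_. b)"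
      unfolding homotopic_loops_def by (rule homotopic_with_mono) simp
    then show ?thesis
      by (simp add: homotopic_constant_maps flip: null_topspace_iff_trivial)
  qed
  then show ?thesis
    by (simp add: path_connected_imp_connected path_connected_component)
qed

section \<open>Transfer to a chart in the plane\<close>

lemma zholomorphic_on_subset:
  "zholomorphic_on X p f V \<Longrightarrow> U \<subseteq> V \<Longrightarrow> zholomorphic_on X p f U"
  by (auto simp: zholomorphic_on_def)

lemma zholomorphic_on_chart_cong:
  fixes X :: "'a::topological_space set"
  assumes U: "openin (top_of_set X) U" and T: "open T" and h: "homeomorphism U T p q"
    and g: "g holomorphic_on T" and eq: "\<And>z. z \<in> T \<Longrightarrow> f (q z) = g z"
  shows "zholomorphic_on X p f U"
proof -
  have "(f \<circ> q) holomorphic_on T"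
    using g by (rule holomorphic_transform) (simp add: eq)
  then show ?thesis by (simp add: zholomorphic_on_chart[OF U T h])
qed

text \<open>Only the values of \<open>f\<close> on one sheet are prescribed. This form can be
  iterated: \<open>zderiv X p f\<close> is again a function whose values on the sheet are known,
  with representative \<open>deriv g\<close>.\<close>

lemma zderiv_chart_cong:
  fixes X :: "'a::topological_space set"
  assumes U: "openin (top_of_set X) U" and T: "open T" and h: "homeomorphism U T p q"
    and g: "g holomorphic_on T" and eq: "\<And>z. z \<in> T \<Longrightarrow> f (q z) = g z" and z: "z \<in> T"
  shows "zderiv X p f (q z) = deriv g z"
proof -
  have qU: "q z \<in> U" "p (q z) = z" using h z by (auto simp: homeomorphism_def)
  have "zderiv X p f (q z) = deriv (f \<circ> q) z"
    using zderiv_chart[OF U T h qU(1) zholomorphic_on_chart_cong[OF U T h g eq]] qU(2) by simp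
  also have "\<dots> = deriv g z"
    by (rule deriv_cong_ev) (use eq T z in \<open>auto simp: eventually_nhds\<close>)
  finally show ?thesis .
qed

lemma hyp_op_chart_cong:
  fixes X :: "'a::topological_space set"
  assumes U: "openin (top_of_set X) U" and T: "open T" and h: "homeomorphism U T p q"
    and g: "g holomorphic_on T" and eq: "\<And>z. z \<in> T \<Longrightarrow> f (q z) = g z" and z: "z \<in> T"
  shows "hyp_op X p \<sigma> \<kappa> f (q z) =
    poly \<sigma> z * deriv (deriv g) z + (poly (pderiv \<sigma>) z + poly \<kappa> z) * deriv g z
    + 1 / 2 * poly (pderiv \<kappa>) z * g z"
proof -
  have 1: "\<And>z. z \<in> T \<Longrightarrow> zderiv X p f (q z) = deriv g z"
    by (rule zderiv_chart_cong[OF U T h g eq])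
  have "zderiv X p (zderiv X p f) (q z) = deriv (deriv g) z"
    by (rule zderiv_chart_cong[OF U T h holomorphic_deriv[OF g T] 1 z])
  moreover have "p (q z) = z" using h z by (auto simp: homeomorphism_def)
  ultimately show ?thesis by (simp add: hyp_op_def 1 eq z)
qed

section \<open>Gauge identity and zeros of solutions in the plane\<close>

lemma hyp_op_gauge_plane:
  fixes r u :: "complex \<Rightarrow> complex"
  assumes T: "open T" and r: "r holomorphic_on T" and u: "u holomorphic_on T"
    and ode: "\<And>w. w \<in> T \<Longrightarrow> poly \<sigma> w * deriv r w = poly \<kappa> w * r w" and z: "z \<in> T"
  shows "poly \<sigma> z * deriv (deriv (\<lambda>w. r w * u w)) z
      + (poly (pderiv \<sigma>) z + poly (- \<kappa>) z) * deriv (\<lambda>w. r w * u w) z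
      + 1 / 2 * poly (pderiv (- \<kappa>)) z * (r z * u z)
    = r z * (poly \<sigma> z * deriv (deriv u) z + (poly (pderiv \<sigma>) z + poly \<kappa> z) * deriv u z
      + 1 / 2 * poly (pderiv \<kappa>) z * u z)"
proof -
  have D: "(g has_field_derivative deriv g w) (at w)"
    if "g holomorphic_on T" "w \<in> T" for g w
    using that T holomorphic_derivI by blast
  note Dr = D[OF r] and Du = D[OF u]
  note Dr' = D[OF holomorphic_deriv[OF r T]] and Du' = D[OF holomorphic_deriv[OF u T]]
  \<comment> \<open>This is needed on all of \<open>T\<close> and not just at \<open>z\<close>,
    since it is differentiated once more.\<close>
  have 1: "deriv (\<lambda>w. r w * u w) w = deriv r w * u w + deriv u w * r w" if "w \<in> T" for w
    by (rule DERIV_imp_deriv) (rule DERIV_mult[OF Dr[OF that] Du[OF that]])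
  have "deriv (deriv (\<lambda>w. r w * u w)) z = deriv (\<lambda>w. deriv r w * u w + deriv u w * r w) z"
    by (rule deriv_cong_ev) (use 1 T z in \<open>auto simp: eventually_nhds\<close>)
  also have "\<dots> = deriv (deriv r) z * u z + deriv u z * deriv r z
      + (deriv (deriv u) z * r z + deriv r z * deriv u z)"
    by (intro DERIV_imp_deriv DERIV_add DERIV_mult Dr Du Dr' Du' z)
  finally have 2: "deriv (deriv (\<lambda>w. r w * u w)) z =
      deriv (deriv r) z * u z + 2 * deriv r z * deriv u z + r z * deriv (deriv u) z"
    by (simp add: algebra_simps)
  \<comment> \<open>The equation holds on a neighbourhood of \<open>z\<close>, so both of its sides
    may be differentiated there.\<close>
  have "deriv (\<lambda>w. poly \<sigma> w * deriv r w) z = deriv (\<lambda>w. poly \<kappa> w * r w) z"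
    by (rule deriv_cong_ev) (use ode T z in \<open>auto simp: eventually_nhds\<close>)
  moreover have "deriv (\<lambda>w. poly \<sigma> w * deriv r w) z =
      poly (pderiv \<sigma>) z * deriv r z + deriv (deriv r) z * poly \<sigma> z"
    by (intro DERIV_imp_deriv DERIV_mult poly_DERIV Dr' z)
  moreover have "deriv (\<lambda>w. poly \<kappa> w * r w) z = poly (pderiv \<kappa>) z * r z + deriv r z * poly \<kappa> z"
    by (intro DERIV_imp_deriv DERIV_mult poly_DERIV Dr z)
  ultimately have 3: "poly (pderiv \<sigma>) z * deriv r z + deriv (deriv r) z * poly \<sigma> z =
      poly (pderiv \<kappa>) z * r z + deriv r z * poly \<kappa> z" by simp
  \<comment> \<open>Compare coefficients. At \<open>deriv (deriv u)\<close> both sides have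
    \<open>\<sigma> r\<close>. At \<open>deriv u\<close> they differ by
    \<open>2 (\<sigma> r' - \<kappa> r)\<close>, zero by \<open>ode\<close>. At \<open>u\<close>
    they differ by \<open>\<sigma> r'' + \<sigma>' r' - \<kappa> r' - \<kappa>' r\<close>, zero by
    \<open>3\<close>; the full \<open>\<kappa>' r\<close> arises from the two halves of opposite
    sign on the two sides.\<close>
  show ?thesis
    unfolding 2 1[OF z] pderiv_minus poly_minus using 3 ode[OF z] by algebra
qed

text \<open>The integrating factor \<open>exp (- H)\<close> turns \<open>r\<close> into a function
  with derivative zero. Convexity gives both the primitive \<open>H\<close> and the constancy of the
  product, and the exponential never vanishes.\<close>

lemma linear_ode_zero_free:
  fixes r :: "complex \<Rightarrow> complex"
  assumes T: "convex T" "open T" and a: "a holomorphic_on T" and r: "r holomorphic_on T"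
    and ode: "\<And>z. z \<in> T \<Longrightarrow> deriv r z = a z * r z" and z: "z \<in> T" and w: "w \<in> T"
  shows "r z = 0 \<longleftrightarrow> r w = 0"
proof -
  obtain H where H: "\<And>z. z \<in> T \<Longrightarrow> (H has_field_derivative a z) (at z within T)"
    using holomorphic_convex_primitive'[OF T a] by blast
  have D: "((\<lambda>z. r z * exp (- H z)) has_field_derivative 0) (at y within T)" if y: "y \<in> T" for y
  proof -
    have "(r has_field_derivative a y * r y) (at y within T)"
      using holomorphic_derivI[OF r T(2) y] ode[OF y] by (auto intro: has_field_derivative_at_within)
    then show ?thesis
      by (auto intro!: derivative_eq_intros H y)
  qed
  obtain c where "\<And>y. y \<in> T \<Longrightarrow> r y * exp (- H y) = c"
    using has_field_derivative_zero_constant[OF T(1) D] by auto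
  then have "r z * exp (- H z) = r w * exp (- H w)" using z w by simp
  then show ?thesis by (metis exp_not_eq_zero mult_eq_0_iff)
qed

section \<open>From charts back to the covering\<close>

text \<open>A single nonzero value is assumed of \<open>\<rho>\<close>; connectedness of
  \<open>X\<close> will spread it. Since \<open>\<sigma>\<close> has no zeros on \<open>S\<close>,
  the equation may be divided by it.\<close>

locale gauge_factor =
  fixes \<sigma> \<kappa> :: "complex poly" and S :: "complex set"
    and X :: "'a::topological_space set" and p \<rho> :: "'a \<Rightarrow> complex"
  assumes S: "open S" "S \<subseteq> {z. poly \<sigma> z \<noteq> 0}"
    and cov: "covering_space X p S" and conn: "connected X"
    and hol: "zholomorphic_on X p \<rho> X" and nz: "\<exists>x\<in>X. \<rho> x \<noteq> 0"
    and ode: "\<And>x. x \<in> X \<Longrightarrow> poly \<sigma> (p x) * zderiv X p \<rho> x = poly \<kappa> (p x) * \<rho> x"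
begin

text \<open>Since \<open>p (q z) = z\<close> on the disc, composing with \<open>q\<close> turns
  \<open>\<rho>\<close> into an ordinary holomorphic solution there. The set \<open>V\<close> allows
  the chart to fit into the domain of a given function.\<close>

lemma chart:
  assumes "openin (top_of_set X) V" "x \<in> V"
  obtains U q r where "r > 0" "x \<in> U" "U \<subseteq> V" "openin (top_of_set X) U"
    "homeomorphism U (ball (p x) r) p q" "ball (p x) r \<subseteq> S"
    "(\<rho> \<circ> q) holomorphic_on ball (p x) r"
    "\<And>z. z \<in> ball (p x) r \<Longrightarrow> poly \<sigma> z * deriv (\<rho> \<circ> q) z = poly \<kappa> z * (\<rho> \<circ> q) z"
proof -
  obtain U q r where *: "r > 0" "x \<in> U" "U \<subseteq> V" "openin (top_of_set X) U"
      "homeomorphism U (ball (p x) r) p q" "ball (p x) r \<subseteq> S"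
    by (rule covering_space_ball_chart[OF cov S(1) assms])
  have UX: "U \<subseteq> X" using openin_subset[OF *(4)] by simp
  have h: "(\<rho> \<circ> q) holomorphic_on ball (p x) r"
    using zholomorphic_on_chart[OF *(4) _ *(5)] zholomorphic_on_subset[OF hol UX] by simp
  have "poly \<sigma> z * deriv (\<rho> \<circ> q) z = poly \<kappa> z * (\<rho> \<circ> q) z" if z: "z \<in> ball (p x) r" for z
  proof -
    have "q z \<in> U" "p (q z) = z" using *(5) z by (auto simp: homeomorphism_def)
    then show ?thesis
      using ode[of "q z"] UX zderiv_chart_cong[OF *(4) _ *(5) h _ z, of \<rho>] by auto
  qed
  then show thesis by (rule that[OF * h])
qed

lemma nowhere_zero:
  assumes "x \<in> X"
  shows "\<rho> x \<noteq> 0"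
proof -
  \<comment> \<open>Vanishing of \<open>\<rho>\<close> is locally constant: two points on one sheet
    over a disc are compared by \<open>linear_ode_zero_free\<close> with coefficient
    \<open>\<kappa> / \<sigma>\<close>.\<close>
  have loc: "\<exists>U. openin (top_of_set X) U \<and> x \<in> U \<and> (\<forall>y\<in>U. \<rho> y = 0 \<longleftrightarrow> \<rho> x = 0)"
    if x: "x \<in> X" for x
  proof -
    obtain U q r where *: "r > 0" "x \<in> U" "openin (top_of_set X) U"
        "homeomorphism U (ball (p x) r) p q" "ball (p x) r \<subseteq> S"
        "(\<rho> \<circ> q) holomorphic_on ball (p x) r"
        "\<And>z. z \<in> ball (p x) r \<Longrightarrow> poly \<sigma> z * deriv (\<rho> \<circ> q) z = poly \<kappa> z * (\<rho> \<circ> q) z"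
      using chart[of X x] x by (metis openin_subtopology_self)
    have s: "poly \<sigma> z \<noteq> 0" if "z \<in> ball (p x) r" for z using that *(5) S(2) by blast
    have "\<rho> y = 0 \<longleftrightarrow> \<rho> x = 0" if y: "y \<in> U" for y
    proof -
      have qp: "q (p y) = y" "q (p x) = x" "p y \<in> ball (p x) r" "p x \<in> ball (p x) r"
        using y *(1,2,4) by (auto simp: homeomorphism_def)
      have "(\<rho> \<circ> q) (p y) = 0 \<longleftrightarrow> (\<rho> \<circ> q) (p x) = 0"
      proof (rule linear_ode_zero_free[OF _ _ _ *(6) _ qp(3,4)])
        show "(\<lambda>z. poly \<kappa> z / poly \<sigma> z) holomorphic_on ball (p x) r"
          using s by (intro holomorphic_intros) auto
        show "deriv (\<rho> \<circ> q) z = poly \<kappa> z / poly \<sigma> z * (\<rho> \<circ> q) z" if "z \<in> ball (p x) r" for z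
          using s[OF that] *(7)[OF that] by (simp add: field_simps)
      qed auto
      then show ?thesis by (simp add: qp)
    qed
    then show ?thesis using *(2,3) by blast
  qed
  \<comment> \<open>The truth value \<open>b\<close> treats the zero set and its complement at
    once.\<close>
  have op: "openin (top_of_set X) {x\<in>X. \<rho> x = 0 \<longleftrightarrow> b}" for b
  proof (subst openin_subopen, intro ballI)
    fix x assume x: "x \<in> {x\<in>X. \<rho> x = 0 \<longleftrightarrow> b}"
    then obtain U where U: "openin (top_of_set X) U" "x \<in> U" "\<forall>y\<in>U. \<rho> y = 0 \<longleftrightarrow> \<rho> x = 0"
      using loc by blast
    then have "U \<subseteq> {x\<in>X. \<rho> x = 0 \<longleftrightarrow> b}" using x openin_imp_subset[OF U(1)] by blast
    then show "\<exists>T. openin (top_of_set X) T \<and> x \<in> T \<and> T \<subseteq> {x\<in>X. \<rho> x = 0 \<longleftrightarrow> b}"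
      using U by blast
  qed
  have "X \<subseteq> {x\<in>X. \<rho> x = 0} \<union> {x\<in>X. \<rho> x \<noteq> 0}"
      "{x\<in>X. \<rho> x = 0} \<inter> {x\<in>X. \<rho> x \<noteq> 0} = {}" by auto
  moreover have "openin (top_of_set X) {x\<in>X. \<rho> x = 0}" "openin (top_of_set X) {x\<in>X. \<rho> x \<noteq> 0}"
    using op[of True] op[of False] by simp_all
  ultimately have "{x\<in>X. \<rho> x = 0} = {} \<or> {x\<in>X. \<rho> x \<noteq> 0} = {}"
    using conn unfolding connected_openin by metis
  \<comment> \<open>By \<open>nz\<close> the second set is not empty, so the zero set is.\<close>
  then show ?thesis using assms nz by auto
qed

text \<open>Prescribing \<open>f\<close> only on \<open>V\<close> serves both claims:
  \<open>u = F\<close> with \<open>f = mult_op \<rho> F\<close>, and \<open>u\<close> the quotient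
  of an arbitrary \<open>f\<close> by \<open>\<rho>\<close>.\<close>

lemma hyp_op_gauge:
  assumes V: "openin (top_of_set X) V" and u: "zholomorphic_on X p u V" and x: "x \<in> V"
    and f: "\<And>y. y \<in> V \<Longrightarrow> f y = \<rho> y * u y"
  shows "hyp_op X p \<sigma> (- \<kappa>) f x = \<rho> x * hyp_op X p \<sigma> \<kappa> u x"
proof -
  obtain U q r where *: "r > 0" "x \<in> U" "U \<subseteq> V" "openin (top_of_set X) U"
      "homeomorphism U (ball (p x) r) p q"
      "(\<rho> \<circ> q) holomorphic_on ball (p x) r"
      "\<And>z. z \<in> ball (p x) r \<Longrightarrow> poly \<sigma> z * deriv (\<rho> \<circ> q) z = poly \<kappa> z * (\<rho> \<circ> q) z"
    using chart[OF V x] by metis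
  have g: "(u \<circ> q) holomorphic_on ball (p x) r"
    using zholomorphic_on_chart[OF *(4) _ *(5)] zholomorphic_on_subset[OF u *(3)] by simp
  have z: "p x \<in> ball (p x) r" and qp: "q (p x) = x"
    using *(1,2,5) by (auto simp: homeomorphism_def)
  have fq: "f (q z) = (\<rho> \<circ> q) z * (u \<circ> q) z" if "z \<in> ball (p x) r" for z
    using f[of "q z"] homeomorphism_image2[OF *(5)] that *(3) by (auto simp del: mem_ball)
  \<comment> \<open>The first two facts express both operators in the chart, the third is the
    identity in the plane, and \<open>q (p x) = x\<close> leads back to \<open>X\<close>.\<close>
  show ?thesis
    using hyp_op_chart_cong[OF *(4) open_ball *(5) holomorphic_on_mult[OF *(6) g] fq z, of \<sigma> "- \<kappa>"]
      hyp_op_chart_cong[OF *(4) open_ball *(5) g _ z, of u \<sigma> \<kappa>]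
      hyp_op_gauge_plane[OF open_ball *(6) g *(7) z]
    by (simp add: qp)
qed

text \<open>Supplies the analytic \<open>u\<close> to which \<open>hyp_op_gauge\<close> is applied
  for the operator identity. As \<open>inverse 0 = 0\<close>, analyticity rests on
  \<open>nowhere_zero\<close>.\<close>

lemma zholomorphic_on_mult_inverse:
  assumes V: "openin (top_of_set X) V" and f: "zholomorphic_on X p f V"
  shows "zholomorphic_on X p (mult_op (\<lambda>x. inverse (\<rho> x)) f) V"
proof -
  have "\<exists>d. has_zderiv X p (mult_op (\<lambda>x. inverse (\<rho> x)) f) d x" if x: "x \<in> V" for x
  proof -
    obtain U q r where *: "x \<in> U" "U \<subseteq> V" "openin (top_of_set X) U"
        "homeomorphism U (ball (p x) r) p q" "(\<rho> \<circ> q) holomorphic_on ball (p x) r"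
      using chart[OF V x] by metis
    have g: "(f \<circ> q) holomorphic_on ball (p x) r"
      using zholomorphic_on_chart[OF *(3) _ *(4)] zholomorphic_on_subset[OF f *(2)] by simp
    have n: "(\<rho> \<circ> q) z \<noteq> 0" if "z \<in> ball (p x) r" for z
      using nowhere_zero[of "q z"] homeomorphism_image2[OF *(4)] that openin_subset[OF *(3)]
      by (auto simp del: mem_ball)
    have "(\<lambda>z. inverse ((\<rho> \<circ> q) z) * (f \<circ> q) z) holomorphic_on ball (p x) r"
      by (intro holomorphic_on_mult holomorphic_on_inverse *(5) g n)
    then have "zholomorphic_on X p (mult_op (\<lambda>x. inverse (\<rho> x)) f) U"
      by (rule zholomorphic_on_chart_cong[OF *(3) open_ball *(4)]) (simp add: mult_op_def)
    then show ?thesis using *(1) by (auto simp: zholomorphic_on_def)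
  qed
  then show ?thesis by (auto simp: zholomorphic_on_def)
qed

end

theorem theorem3p1:
  fixes \<sigma> \<kappa> :: "complex poly" and \<omega> :: complex
    and S :: "complex set" and X :: "'a::topological_space set"
    and p \<rho> :: "'a \<Rightarrow> complex"
  assumes "degree \<sigma> \<le> 2" and "\<sigma> \<noteq> 0" and "degree \<kappa> \<le> 1"
    and "open S" and "connected S" and "S \<subseteq> {z. poly \<sigma> z \<noteq> 0}"
    and "covering_space X p S" and "simply_connected X"
    and "zholomorphic_on X p \<rho> X" and "\<exists>x\<in>X. \<rho> x \<noteq> 0"
    and "\<forall>x\<in>X. poly \<sigma> (p x) * zderiv X p \<rho> x - poly \<kappa> (p x) * \<rho> x = 0"
  shows "diffop_eq X p
           (mult_op \<rho> \<circ> hyp_op X p \<sigma> \<kappa> \<circ> mult_op (\<lambda>x. inverse (\<rho> x)))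
           (hyp_op X p \<sigma> (- \<kappa>)) \<and>
         (\<forall>V F. openin (top_of_set X) V \<longrightarrow> zholomorphic_on X p F V \<longrightarrow>
            (\<forall>x\<in>V. hyp_op X p \<sigma> \<kappa> F x + \<omega> * F x = 0) \<longrightarrow>
            (\<forall>x\<in>V. hyp_op X p \<sigma> (- \<kappa>) (mult_op \<rho> F) x + \<omega> * mult_op \<rho> F x = 0))"
proof -
  interpret gauge_factor \<sigma> \<kappa> S X p \<rho>
    by unfold_locales (use assms simply_connected_imp_connected_general in auto)
  have "(mult_op \<rho> \<circ> hyp_op X p \<sigma> \<kappa> \<circ> mult_op (\<lambda>x. inverse (\<rho> x))) f x = hyp_op X p \<sigma> (- \<kappa>) f x"
    if V: "openin (top_of_set X) V" and f: "zholomorphic_on X p f V" and x: "x \<in> V" for V f x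
  proof -
    have "f y = \<rho> y * mult_op (\<lambda>x. inverse (\<rho> x)) f y" if "y \<in> V" for y
      using nowhere_zero[of y] openin_subset[OF V] that by (auto simp: mult_op_def)
    from hyp_op_gauge[OF V zholomorphic_on_mult_inverse[OF V f] x this]
    show ?thesis by (simp add: mult_op_def)
  qed
  moreover have "hyp_op X p \<sigma> (- \<kappa>) (mult_op \<rho> F) x + \<omega> * mult_op \<rho> F x = 0"
    if V: "openin (top_of_set X) V" and F: "zholomorphic_on X p F V" and x: "x \<in> V"
      and eq: "\<forall>x\<in>V. hyp_op X p \<sigma> \<kappa> F x + \<omega> * F x = 0" for V F x
  proof -
    \<comment> \<open>The constant \<open>\<omega>\<close> commutes with multiplication by
      \<open>\<rho>\<close>, so the gauge identity persists after adding it.\<close>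
    have "hyp_op X p \<sigma> (- \<kappa>) (mult_op \<rho> F) x + \<omega> * mult_op \<rho> F x
        = \<rho> x * (hyp_op X p \<sigma> \<kappa> F x + \<omega> * F x)"
      using hyp_op_gauge[OF V F x, of "mult_op \<rho> F"] by (simp add: mult_op_def algebra_simps)
    then show ?thesis using eq x by simp
  qed
  ultimately show ?thesis unfolding diffop_eq_def by blast
qed

end
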